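(* If the $N\times N$ matrix $\mathbb{L}$ with entries $L(i,j)=\langle\tilde\phi_i,\phi_j\rangle$ is nonsingular and $\mathbf{\Theta}=\mathbb{L}^{-1}\tilde{\mathbf{\Phi}}$, then $$ \left\langle \mathcal{A}\prod_{j=1}^N \tilde{\phi}_j(\gamma_j), \left( \sum_{i=1}^N\Big(-\frac{1}{2}\Delta_i+ v(\mathbf{r}_i)\Big) \right)\prod_{j=1}^N \phi_j(\gamma_j) \right\rangle $$ is equal to $$ \frac{|\mathbb{L}|}{N!} \int (\mathcal{T}_*+\mathcal{V}_* )[\mathbf{\Phi}]^*\,\mathbf{\Theta}\; d\gamma . $$
   Context: $N\ge1$ is an integer. A particle variable is $\gamma=(\mathbf{r},\sigma)$ with $\mathbf{r}\in\mathbb{R}^3$ and $\sigma\in\{-\frac12,\frac12\}$, and $\int f(\gamma)\,d\gamma=\sum_{\sigma}\int_{\mathbb{R}^3}f(\mathbf{r},\sigma)\,d\mathbf{r}$. The inner product is $\langle f,g\rangle=\int f\,\overline{g}$ (over $\gamma$, or over $\gamma_1,\dots,\gamma_N$ for $N$-particle functions). $\Delta_i$ is the three-dimensional Laplacian in $\mathbf{r}_i$, and $v(\mathbf{r})$ is a finite sum of terms $-Z_a/\|\mathbf{r}-\mathbf{R}_a\|$ with nuclear charges $Z_a>0$ and positions $\mathbf{R}_a\in\mathbb{R}^3$. The one-particle operator is $(\mathcal{T}_*+\mathcal{V}_* )[f](\gamma)=\left(-\frac12\Delta+v(\mathbf{r})\right)f(\mathbf{r},\sigma)$, applied entrywise to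 vectors of functions. $\phi_1,\dots,\phi_N$ and $\tilde\phi_1,\dots,\tilde\phi_N$ are complex-valued square-integrable functions of $\gamma$, regular enough that $(\mathcal{T}_*+\mathcal{V}_* )[\phi_i]$ is defined and all integrals written converge absolutely. $\mathbf{\Phi}=[\phi_1,\dots,\phi_N]^T$ and $\tilde{\mathbf{\Phi}}=[\tilde\phi_1,\dots,\tilde\phi_N]^T$ are column vectors of functions of one variable, and $^*$ is conjugate transpose. $|\cdot|$ is the determinant. $\mathcal{A}$ is the antisymmetrizer, $(\mathcal{A}F)(\gamma_1,\dots,\gamma_N)=\frac1{N!}\sum_{\pi\in S_N}\mathrm{sgn}(\pi)F(\gamma_{\pi(1)},\dots,\gamma_{\pi(N)})$. *)

theory Defs
  imports "HOL-Analysis.Analysis"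
begin

type_synonym particle = "(real ^ 3) \<times> real"

abbreviation spins :: "real set" where
  "spins \<equiv> {- 1 / 2, 1 / 2}"

definition particle_measure :: "particle measure" where
  "particle_measure = lebesgue \<Otimes>\<^sub>M count_space spins"

text \<open>An \<open>N\<close>-particle configuration is a function from a finite index type \<open>'n\<close> with
  \<open>N = CARD('n)\<close> elements to particle variables.\<close>

definition particles_measure :: "('n::finite \<Rightarrow> particle) measure" where
  "particles_measure = Pi\<^sub>M UNIV (\<lambda>_. particle_measure)"

definition inner_prod :: "'a measure \<Rightarrow> ('a \<Rightarrow> complex) \<Rightarrow> ('a \<Rightarrow> complex) \<Rightarrow> complex" where
  "inner_prod M f g = (\<integral>x. f x * cnj (g x) \<partial>M)"

definition square_integrable :: "'a measure \<Rightarrow> ('a \<Rightarrow> complex) \<Rightarrow> bool" where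
  "square_integrable M f \<longleftrightarrow>
     f \<in> borel_measurable M \<and> integrable M (\<lambda>x. (cmod (f x))\<^sup>2)"

definition twice_differentiable_along ::
    "('a::real_normed_vector \<Rightarrow> complex) \<Rightarrow> 'a \<Rightarrow> 'a \<Rightarrow> bool" where
  "twice_differentiable_along f x e \<longleftrightarrow>
     (\<forall>\<^sub>F t in nhds 0. (\<lambda>s. f (x + s *\<^sub>R e)) differentiable (at t)) \<and>
     (\<lambda>t. vector_derivative (\<lambda>s. f (x + s *\<^sub>R e)) (at t)) differentiable (at 0)"

definition second_derivative_along ::
    "('a::real_normed_vector \<Rightarrow> complex) \<Rightarrow> 'a \<Rightarrow> 'a \<Rightarrow> complex" where
  "second_derivative_along f x e =
     vector_derivative (\<lambda>t. vector_derivative (\<lambda>s. f (x + s *\<^sub>R e)) (at t)) (at 0)"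

definition laplacian_exists :: "('a::euclidean_space \<Rightarrow> complex) \<Rightarrow> 'a \<Rightarrow> bool" where
  "laplacian_exists f x \<longleftrightarrow> (\<forall>e\<in>Basis. twice_differentiable_along f x e)"

text \<open>The Laplacian is a pointwise one, with value 0 at the points where a pure second partial
  derivative does not exist. Orbitals have cusps at the nuclei, so below these points are only
  assumed to form a null set.\<close>

definition laplacian :: "('a::euclidean_space \<Rightarrow> complex) \<Rightarrow> 'a \<Rightarrow> complex" where
  "laplacian f x =
     (if laplacian_exists f x then \<Sum>e\<in>Basis. second_derivative_along f x e else 0)"

text \<open>At a nucleus the corresponding term is 0, by the convention for division by 0.\<close>

definition nuclear_potential ::
    "'a set \<Rightarrow> ('a \<Rightarrow> real) \<Rightarrow> ('a \<Rightarrow> real ^ 3) \<Rightarrow> real ^ 3 \<Rightarrow> real" where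
  "nuclear_potential A Z R r = (\<Sum>a\<in>A. - Z a / norm (r - R a))"

definition one_particle_op ::
    "(real ^ 3 \<Rightarrow> real) \<Rightarrow> (particle \<Rightarrow> complex) \<Rightarrow> particle \<Rightarrow> complex" where
  "one_particle_op v f \<gamma> =
     - (1 / 2) * laplacian (\<lambda>r. f (r, snd \<gamma>)) (fst \<gamma>) + of_real (v (fst \<gamma>)) * f \<gamma>"

definition one_particle_op_vec ::
    "(real ^ 3 \<Rightarrow> real) \<Rightarrow> (particle \<Rightarrow> complex ^ 'n) \<Rightarrow> particle \<Rightarrow> complex ^ 'n" where
  "one_particle_op_vec v F \<gamma> = (\<chi> i. one_particle_op v (\<lambda>\<gamma>'. F \<gamma>' $ i) \<gamma>)"

definition laplacian_at ::
    "'n \<Rightarrow> (('n \<Rightarrow> particle) \<Rightarrow> complex) \<Rightarrow> ('n \<Rightarrow> particle) \<Rightarrow> complex" where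
  "laplacian_at i F \<gamma> = laplacian (\<lambda>r. F (\<gamma>(i := (r, snd (\<gamma> i))))) (fst (\<gamma> i))"

definition sum_one_particle_op ::
    "(real ^ 3 \<Rightarrow> real) \<Rightarrow> (('n::finite \<Rightarrow> particle) \<Rightarrow> complex) \<Rightarrow> ('n \<Rightarrow> particle) \<Rightarrow> complex" where
  "sum_one_particle_op v F \<gamma> =
     (\<Sum>i\<in>UNIV. - (1 / 2) * laplacian_at i F \<gamma> + of_real (v (fst (\<gamma> i))) * F \<gamma>)"

definition antisymmetrizer ::
    "(('n::finite \<Rightarrow> particle) \<Rightarrow> complex) \<Rightarrow> ('n \<Rightarrow> particle) \<Rightarrow> complex" where
  "antisymmetrizer F \<gamma> =
     1 / fact CARD('n) *
       (\<Sum>\<pi> | \<pi> permutes (UNIV :: 'n set). of_int (sign \<pi>) * F (\<lambda>j. \<gamma> (\<pi> j)))"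

definition product_fun ::
    "('n::finite \<Rightarrow> particle \<Rightarrow> complex) \<Rightarrow> ('n \<Rightarrow> particle) \<Rightarrow> complex" where
  "product_fun \<phi> \<gamma> = (\<Prod>j\<in>UNIV. \<phi> j (\<gamma> j))"

definition column_fun :: "('n \<Rightarrow> particle \<Rightarrow> complex) \<Rightarrow> particle \<Rightarrow> complex ^ 'n" where
  "column_fun \<phi> \<gamma> = (\<chi> i. \<phi> i \<gamma>)"

definition overlap_matrix ::
    "('n \<Rightarrow> particle \<Rightarrow> complex) \<Rightarrow> ('n \<Rightarrow> particle \<Rightarrow> complex) \<Rightarrow> complex ^ 'n ^ 'n" where
  "overlap_matrix \<psi> \<phi> = (\<chi> i j. inner_prod particle_measure (\<psi> i) (\<phi> j))"

text \<open>The scalar \<open>u\<^sup>* w\<close> for column vectors \<open>u\<close>, \<open>w\<close>.\<close>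

definition adjoint_mult :: "complex ^ 'n \<Rightarrow> complex ^ 'n \<Rightarrow> complex" where
  "adjoint_mult u w = (\<Sum>i\<in>UNIV. cnj (u $ i) * w $ i)"

lemma sigma_finite_lebesgue:
  "sigma_finite_measure (lebesgue :: 'a::euclidean_space measure)"
proof
  obtain A :: "nat \<Rightarrow> 'a set" where A: "range A \<subseteq> sets lborel" "(\<Union>i. A i) = space lborel"
      "\<And>i. emeasure lborel (A i) \<noteq> \<infinity>"
    using lborel.sigma_finite by blast
  have "countable (range A)" "range A \<subseteq> sets lebesgue" "\<Union> (range A) = space lebesgue"
    using A by auto
  moreover have "\<forall>a\<in>range A. emeasure lebesgue a \<noteq> \<infinity>"
    using A by (auto simp: image_subset_iff)
  ultimately show "\<exists>A::'a set set. countable A \<and> A \<subseteq> sets lebesgue \<and> \<Union> A = space lebesgue \<and>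
      (\<forall>a\<in>A. emeasure lebesgue a \<noteq> \<infinity>)"
    by blast
qed

lemma integral_particle_measure:
  fixes f :: "particle \<Rightarrow> complex"
  assumes "integrable particle_measure f"
  shows "(\<integral>\<gamma>. f \<gamma> \<partial>particle_measure) = (\<Sum>\<sigma>\<in>spins. \<integral>r. f (r, \<sigma>) \<partial>lebesgue)"
proof -
  interpret pair_sigma_finite "lebesgue :: (real ^ 3) measure" "count_space spins"
    by (intro pair_sigma_finite.intro sigma_finite_lebesgue sigma_finite_measure_count_space_finite)
       simp
  have "(\<integral>\<gamma>. f \<gamma> \<partial>particle_measure) = (\<integral>\<sigma>. (\<integral>r. f (r, \<sigma>) \<partial>lebesgue) \<partial>count_space spins)"
    using integral_snd[of "\<lambda>r \<sigma>. f (r, \<sigma>)"] assms by (simp add: particle_measure_def)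
  then show ?thesis
    by (simp add: lebesgue_integral_count_space_finite)
qed

end

theory Submission
  imports Defs
begin

text \<open>
  Write \<open>h\<^sub>i\<close> for the one-particle operator applied to \<open>\<phi>\<^sub>i\<close>. Up to the factor \<open>N!\<close> the integrand is a
  sum over \<open>i\<close> of terms \<open>cnj (h\<^sub>i (\<gamma>\<^sub>i)) (\<Prod>j\<noteq>i. cnj (\<phi>\<^sub>j (\<gamma>\<^sub>j))) det (\<phi>t\<^sub>k (\<gamma>\<^sub>l))\<close>. Integrating the
  \<open>i\<close>-th term over all \<open>\<gamma>\<^sub>j\<close> with \<open>j \<noteq> i\<close> replaces the determinant by that of \<open>L\<close> with column
  \<open>i\<close> exchanged for \<open>\<phi>t (\<gamma>\<^sub>i)\<close>, which by Cramer's rule is \<open>det L\<close> times the \<open>i\<close>-th entry of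
  \<open>\<Theta> (\<gamma>\<^sub>i)\<close>.

  Only the total integrand is assumed integrable, so Fubini's theorem does not apply directly to a
  single term. Fix \<open>i\<close> and almost any value \<open>y\<close> of the other variables. In the variable \<open>\<gamma>\<^sub>i\<close> all
  other terms are integrable, being combinations of products of two square-integrable functions,
  hence so is the \<open>i\<close>-th one. It has the form \<open>\<Sum>k. c\<^sub>k y * f\<^sub>k x\<close> with integrable
  \<open>c\<^sub>k\<close>. The coefficient vectors \<open>w\<close> for which \<open>\<Sum>k. w\<^sub>k * f\<^sub>k x\<close> is integrable form a subspace
  which contains \<open>c y\<close> for almost all \<open>y\<close>; expanding \<open>c\<close> in a basis of it shows that the term is
  jointly integrable.
\<close>

section \<open>Integration with respect to the completed measure\<close>

text \<open>The integral with respect to the completion of \<open>M\<close>. It makes it unnecessary to know that the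
  pointwise Laplacian of an orbital is measurable.\<close>

definition has_completed_integral ::
    "'a measure \<Rightarrow> ('a \<Rightarrow> complex) \<Rightarrow> complex \<Rightarrow> bool" where
  "has_completed_integral M f I \<longleftrightarrow>
     (\<exists>g. integrable M g \<and> (AE x in M. f x = g x) \<and> integral\<^sup>L M g = I)"

lemma has_completed_integralI:
  "integrable M g \<Longrightarrow> AE x in M. f x = g x \<Longrightarrow> integral\<^sup>L M g = I \<Longrightarrow> has_completed_integral M f I"
  unfolding has_completed_integral_def by blast

lemma has_completed_integral_integrable:
  "integrable M f \<Longrightarrow> has_completed_integral M f (integral\<^sup>L M f)"
  by (rule has_completed_integralI) auto

text \<open>The Bochner integral of a non-measurable function is 0 by convention, so integrability
  of \<open>f\<close> itself is what ties its integral to that of a representative.\<close>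

lemma has_completed_integral_integral_eq:
  assumes "has_completed_integral M f I" "integrable M f"
  shows "integral\<^sup>L M f = I"
proof -
  obtain g where "integrable M g" "AE x in M. f x = g x" "integral\<^sup>L M g = I"
    using assms unfolding has_completed_integral_def by blast
  then show ?thesis
    using integral_cong_AE[of f M g] assms(2) by auto
qed

lemma has_completed_integral_cong_AE:
  assumes "has_completed_integral M f I" "AE x in M. f x = g x"
  shows "has_completed_integral M g I"
proof -
  obtain u where u: "integrable M u" "AE x in M. f x = u x" "integral\<^sup>L M u = I"
    using assms unfolding has_completed_integral_def by blast
  have "AE x in M. g x = u x"
    using u(2) assms(2) by eventually_elim simp
  with u show ?thesis by (intro has_completed_integralI)
qed

lemma has_completed_integral_zero: "has_completed_integral M (\<lambda>x. 0) 0"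
  by (rule has_completed_integralI[of _ "\<lambda>_. 0"]) auto

lemma has_completed_integral_add:
  assumes "has_completed_integral M f I" "has_completed_integral M g J"
  shows "has_completed_integral M (\<lambda>x. f x + g x) (I + J)"
proof -
  obtain u w where u: "integrable M u" "AE x in M. f x = u x" "integral\<^sup>L M u = I"
    and w: "integrable M w" "AE x in M. g x = w x" "integral\<^sup>L M w = J"
    using assms unfolding has_completed_integral_def by blast
  have "AE x in M. f x + g x = u x + w x"
    using u(2) w(2) by eventually_elim simp
  with u w show ?thesis
    by (intro has_completed_integralI[of _ "\<lambda>x. u x + w x"]) auto
qed

lemma has_completed_integral_cmult:
  assumes "has_completed_integral M f I"
  shows "has_completed_integral M (\<lambda>x. c * f x) (c * I)"
proof -
  obtain u where u: "integrable M u" "AE x in M. f x = u x" "integral\<^sup>L M u = I"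
    using assms unfolding has_completed_integral_def by blast
  have "AE x in M. c * f x = c * u x"
    using u(2) by eventually_elim simp
  with u show ?thesis
    by (intro has_completed_integralI[of _ "\<lambda>x. c * u x"]) auto
qed

lemma has_completed_integral_diff:
  assumes "has_completed_integral M f I" "has_completed_integral M g J"
  shows "has_completed_integral M (\<lambda>x. f x - g x) (I - J)"
  using has_completed_integral_add[OF assms(1) has_completed_integral_cmult[OF assms(2), of "-1"]]
  by simp

lemma has_completed_integral_sum:
  assumes "\<And>i. i \<in> K \<Longrightarrow> has_completed_integral M (f i) (I i)"
  shows "has_completed_integral M (\<lambda>x. \<Sum>i\<in>K. f i x) (\<Sum>i\<in>K. I i)"
  using assms
  by (induction K rule: infinite_finite_induct)
     (auto intro: has_completed_integral_zero has_completed_integral_add)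

text \<open>A measure-preserving map pulls null sets back to null sets, and the change of variables
  is applied to the measurable representative \<open>u\<close>.\<close>

lemma has_completed_integral_distr:
  assumes "has_completed_integral N f I" and T: "T \<in> measurable M N" and N: "distr M N T = N"
  shows "has_completed_integral M (\<lambda>x. f (T x)) I"
proof -
  obtain u where u: "integrable N u" "AE x in N. f x = u x" "integral\<^sup>L N u = I"
    using assms unfolding has_completed_integral_def by blast
  have [measurable]: "u \<in> borel_measurable N" using u by auto
  show ?thesis
  proof (rule has_completed_integralI)
    show "integrable M (\<lambda>x. u (T x))"
      using u(1) integrable_distr[OF T, of u] N by simp
    show "AE x in M. f (T x) = u (T x)"
      using u(2) by (intro AE_distrD[OF T]) (simp only: N)
    show "integral\<^sup>L M (\<lambda>x. u (T x)) = I"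
      using integral_distr[OF T, of u] u(3) N by simp
  qed
qed

section \<open>Null sets and tensor products on product spaces\<close>

text \<open>\<open>P\<close> may be non-measurable, so the proof covers the exceptions by a null
  set. The cylinder over it is null even if \<open>M2\<close> is infinite, as 0 times infinity is 0
  in \<open>ennreal\<close>.\<close>

lemma AE_pair_fst:
  assumes "sigma_finite_measure M2" "AE x in M1. P x"
  shows "AE p in M1 \<Otimes>\<^sub>M M2. P (fst p)"
proof -
  interpret M2: sigma_finite_measure M2 by fact
  obtain N where N: "N \<in> null_sets M1" "{x \<in> space M1. \<not> P x} \<subseteq> N"
    using assms(2) by (auto simp: eventually_ae_filter)
  have "N \<times> space M2 \<in> null_sets (M1 \<Otimes>\<^sub>M M2)"
    using N by (auto simp: null_sets_def M2.emeasure_pair_measure_Times)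
  then show ?thesis
    by (rule AE_I') (use N in \<open>auto simp: space_pair_measure\<close>)
qed

lemma AE_pair_snd:
  assumes "sigma_finite_measure M2" "AE x in M2. P x"
  shows "AE p in M1 \<Otimes>\<^sub>M M2. P (snd p)"
proof -
  interpret M2: sigma_finite_measure M2 by fact
  obtain N where N: "N \<in> null_sets M2" "{x \<in> space M2. \<not> P x} \<subseteq> N"
    using assms(2) by (auto simp: eventually_ae_filter)
  have "space M1 \<times> N \<in> null_sets (M1 \<Otimes>\<^sub>M M2)"
    using N by (auto simp: null_sets_def M2.emeasure_pair_measure_Times)
  then show ?thesis
    by (rule AE_I') (use N in \<open>auto simp: space_pair_measure\<close>)
qed

lemma integrable_tensor:
  fixes c :: "'a \<Rightarrow> complex" and g :: "'b \<Rightarrow> complex"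
  assumes "sigma_finite_measure M1" "sigma_finite_measure M2"
    and c: "integrable M1 c" and g: "integrable M2 g"
  shows "integrable (M1 \<Otimes>\<^sub>M M2) (\<lambda>p. c (fst p) * g (snd p))"
    and "(\<integral>p. c (fst p) * g (snd p) \<partial>(M1 \<Otimes>\<^sub>M M2)) = integral\<^sup>L M1 c * integral\<^sup>L M2 g"
proof -
  interpret pair_sigma_finite M1 M2 by (intro pair_sigma_finite.intro assms)
  have [measurable]: "c \<in> borel_measurable M1" "g \<in> borel_measurable M2"
    using c g by auto
  show i: "integrable (M1 \<Otimes>\<^sub>M M2) (\<lambda>p. c (fst p) * g (snd p))"
  proof (rule Fubini_integrable)
    show "integrable M1 (\<lambda>x. \<integral>y. norm (c (fst (x, y)) * g (snd (x, y))) \<partial>M2)"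
      using c g by (simp add: norm_mult)
  qed (use g in auto)
  show "(\<integral>p. c (fst p) * g (snd p) \<partial>(M1 \<Otimes>\<^sub>M M2)) = integral\<^sup>L M1 c * integral\<^sup>L M2 g"
    using integral_fst'[OF i] by simp
qed

lemma has_completed_integral_tensor:
  assumes M: "sigma_finite_measure M1" "sigma_finite_measure M2"
    and c: "integrable M1 c" and g: "has_completed_integral M2 g I"
  shows "has_completed_integral (M1 \<Otimes>\<^sub>M M2) (\<lambda>p. c (fst p) * g (snd p)) (integral\<^sup>L M1 c * I)"
proof -
  obtain u where u: "integrable M2 u" "AE x in M2. g x = u x" "integral\<^sup>L M2 u = I"
    using g unfolding has_completed_integral_def by blast
  have "AE p in M1 \<Otimes>\<^sub>M M2. c (fst p) * g (snd p) = c (fst p) * u (snd p)"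
    using AE_pair_snd[OF M(2) u(2)] by eventually_elim simp
  then show ?thesis
    using integrable_tensor[OF M c u(1)] u(3) by (intro has_completed_integralI) auto
qed

text \<open>A Fubini theorem for functions of finite rank whose single factors \<open>f k\<close>
  may fail to be integrable. The basis expansion takes the form of an elimination of one
  \<open>f l\<close> at a time. The common value \<open>I\<close> says that integrating the
  coefficients first gives the joint integral.\<close>

lemma has_completed_integral_sum_tensor:
  fixes c :: "'k \<Rightarrow> 'a \<Rightarrow> complex" and f :: "'k \<Rightarrow> 'b \<Rightarrow> complex"
  assumes M: "sigma_finite_measure M1" "sigma_finite_measure M2" and "finite K"
    and "\<And>k. k \<in> K \<Longrightarrow> integrable M1 (c k)"
    and "AE y in M1. \<exists>I. has_completed_integral M2 (\<lambda>x. \<Sum>k\<in>K. c k y * f k x) I"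
  shows "\<exists>I. has_completed_integral M2 (\<lambda>x. \<Sum>k\<in>K. integral\<^sup>L M1 (c k) * f k x) I \<and>
             has_completed_integral (M1 \<Otimes>\<^sub>M M2) (\<lambda>p. \<Sum>k\<in>K. c k (fst p) * f k (snd p)) I"
  using assms(3-)
proof (induction K arbitrary: c rule: finite_induct)
  case empty
  show ?case by (auto intro!: exI[of _ 0] has_completed_integral_zero)
next
  case (insert l K)
  note ins = insert.hyps
  have cK: "integrable M1 (c k)" if "k \<in> K" for k using insert.prems that by auto
  have cl: "integrable M1 (c l)" using insert.prems by auto
  txt \<open>Either some admissible coefficient vector allows \<open>f l\<close> to be eliminated, or \<open>c l\<close> vanishes
    almost everywhere.\<close>
  show ?case
  proof (cases "\<exists>w I. w l \<noteq> 0 \<and> has_completed_integral M2 (\<lambda>x. \<Sum>k\<in>insert l K. w k * f k x) I")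
    case True
    then obtain w I where w: "w l \<noteq> 0"
      and I: "has_completed_integral M2 (\<lambda>x. \<Sum>k\<in>insert l K. w k * f k x) I" by blast
    define g where "g = (\<lambda>x. \<Sum>k\<in>insert l K. w k * f k x)"
    \<comment> \<open>Subtracting \<open>a y * g x\<close> cancels the coefficient of
      \<open>f l\<close>; the \<open>d k y\<close> are the coefficients that remain.\<close>
    define a where "a = (\<lambda>y. c l y / w l)"
    define d where "d k y = c k y - a y * w k" for k y
    have split: "(\<Sum>k\<in>insert l K. s k * f k x) - s l / w l * g x
        = (\<Sum>k\<in>K. (s k - s l / w l * w k) * f k x)" for s :: "'k \<Rightarrow> complex" and x
      using w ins by (simp add: g_def sum_distrib_left sum_subtractf algebra_simps)
    have a: "integrable M1 a" unfolding a_def using cl by simp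
    have int_a: "integral\<^sup>L M1 a = integral\<^sup>L M1 (c l) / w l" unfolding a_def by simp
    have d: "integrable M1 (d k)" if "k \<in> K" for k
      unfolding d_def using a cK[OF that] by auto
    have int_d: "integral\<^sup>L M1 (d k) = integral\<^sup>L M1 (c k) - integral\<^sup>L M1 a * w k"
      if "k \<in> K" for k
      unfolding d_def using a cK[OF that] by auto
    have "AE y in M1. \<exists>J. has_completed_integral M2 (\<lambda>x. \<Sum>k\<in>K. d k y * f k x) J"
      using insert.prems(2)
    proof eventually_elim
      case (elim y)
      then obtain J where "has_completed_integral M2 (\<lambda>x. \<Sum>k\<in>insert l K. c k y * f k x) J" by blast
      from has_completed_integral_diff[OF this has_completed_integral_cmult[OF I[folded g_def], of "a y"]]
      show ?case
        unfolding d_def a_def split[of "\<lambda>k. c k y"] by blast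
    qed
    from insert.IH[OF d this] obtain J where
      J1: "has_completed_integral M2 (\<lambda>x. \<Sum>k\<in>K. integral\<^sup>L M1 (d k) * f k x) J" and
      J2: "has_completed_integral (M1 \<Otimes>\<^sub>M M2) (\<lambda>p. \<Sum>k\<in>K. d k (fst p) * f k (snd p)) J"
      by blast
    \<comment> \<open>The elimination is undone: \<open>a\<close> times \<open>g\<close> separates
      the variables with both factors integrable, \<open>g\<close> in the completed sense, and the
      induction hypothesis covers the rest.\<close>
    have "has_completed_integral M2 (\<lambda>x. integral\<^sup>L M1 a * g x + (\<Sum>k\<in>K. integral\<^sup>L M1 (d k) * f k x))
        (integral\<^sup>L M1 a * I + J)"
      by (intro has_completed_integral_add has_completed_integral_cmult J1 I[folded g_def])
    moreover have "has_completed_integral (M1 \<Otimes>\<^sub>M M2)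
        (\<lambda>p. a (fst p) * g (snd p) + (\<Sum>k\<in>K. d k (fst p) * f k (snd p))) (integral\<^sup>L M1 a * I + J)"
      by (intro has_completed_integral_add has_completed_integral_tensor M a J2 I[folded g_def])
    moreover have "a y * g x + (\<Sum>k\<in>K. d k y * f k x) = (\<Sum>k\<in>insert l K. c k y * f k x)" for x y
      using split[of "\<lambda>k. c k y" x] by (simp add: a_def d_def algebra_simps)
    moreover have "integral\<^sup>L M1 a * g x + (\<Sum>k\<in>K. integral\<^sup>L M1 (d k) * f k x)
        = (\<Sum>k\<in>insert l K. integral\<^sup>L M1 (c k) * f k x)" for x
      using split[of "\<lambda>k. integral\<^sup>L M1 (c k)" x] by (simp add: int_d int_a diff_eq_eq add.commute)
    ultimately show ?thesis by (simp only:) blast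
  next
    case False
    \<comment> \<open>Where the combination at \<open>y\<close> has an integral, a nonzero
      \<open>c l y\<close> would make \<open>\<lambda>k. c k y\<close> a witness \<open>w\<close>,
      which this case excludes.\<close>
    have z: "AE y in M1. c l y = 0"
      using insert.prems(2) False by (auto elim!: eventually_mono)
    have "AE y in M1. \<exists>I. has_completed_integral M2 (\<lambda>x. \<Sum>k\<in>K. c k y * f k x) I"
      using insert.prems(2) z by eventually_elim (use ins in auto)
    from insert.IH[OF cK this] obtain J where
      J1: "has_completed_integral M2 (\<lambda>x. \<Sum>k\<in>K. integral\<^sup>L M1 (c k) * f k x) J" and
      J2: "has_completed_integral (M1 \<Otimes>\<^sub>M M2) (\<lambda>p. \<Sum>k\<in>K. c k (fst p) * f k (snd p)) J"
      by blast
    have "integral\<^sup>L M1 (c l) = 0"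
      using z cl by (subst integral_cong_AE[of _ _ "\<lambda>_. 0"]) auto
    moreover have "has_completed_integral (M1 \<Otimes>\<^sub>M M2)
        (\<lambda>p. \<Sum>k\<in>insert l K. c k (fst p) * f k (snd p)) J"
      by (rule has_completed_integral_cong_AE[OF J2])
         (use AE_pair_fst[OF M(2) z] ins in \<open>auto elim!: eventually_mono\<close>)
    ultimately show ?thesis using J1 ins by (auto intro!: exI[of _ J])
  qed
qed

section \<open>Splitting one coordinate off a finite product measure\<close>

text \<open>The preimage of a box is a box with the same product of side measures, and boxes
  determine a finite product of sigma-finite measures.\<close>

lemma (in product_sigma_finite) distr_insert:
  assumes I: "finite I" "i \<notin> I"
  shows "distr (Pi\<^sub>M I M \<Otimes>\<^sub>M M i) (Pi\<^sub>M (insert i I) M) (\<lambda>(f, y). f(i := y)) = Pi\<^sub>M (insert i I) M"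
    (is "?D = ?P")
proof (rule PiM_eqI)
  interpret I: finite_product_sigma_finite M I by standard fact
  fix A assume A: "\<And>j. j \<in> insert i I \<Longrightarrow> A j \<in> sets (M j)"
  have *: "((\<lambda>(f, y). f(i := y)) -` Pi\<^sub>E (insert i I) A \<inter> space (Pi\<^sub>M I M \<Otimes>\<^sub>M M i)) = Pi\<^sub>E I A \<times> A i"
    using A[THEN sets.sets_into_space] I
    by (fastforce simp: space_PiM space_pair_measure PiE_iff extensional_def split: if_splits)
  show "emeasure ?D (Pi\<^sub>E (insert i I) A) = (\<Prod>j\<in>insert i I. emeasure (M j) (A j))"
    using A I
    by (subst emeasure_distr)
       (auto simp: * M.emeasure_pair_measure_Times I.measure_times mult.commute
             intro!: sets_PiM_I_finite measurable_add_dim)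
qed (use I in simp_all)

lemma (in product_sigma_finite) distr_remove:
  assumes I: "finite I" "i \<notin> I"
  shows "distr (Pi\<^sub>M (insert i I) M) (Pi\<^sub>M I M \<Otimes>\<^sub>M M i) (\<lambda>f. (restrict f I, f i)) = Pi\<^sub>M I M \<Otimes>\<^sub>M M i"
    (is "distr ?P ?Q ?r = _")
proof -
  have r: "?r \<in> measurable ?P ?Q"
    by (auto intro!: measurable_Pair measurable_restrict_subset)
  have "distr ?P ?Q ?r = distr (distr ?Q ?P (\<lambda>(f, y). f(i := y))) ?Q ?r"
    by (simp add: distr_insert[OF I])
  also have "\<dots> = distr ?Q ?Q (?r \<circ> (\<lambda>(f, y). f(i := y)))"
    by (intro distr_distr r measurable_add_dim)
  \<comment> \<open>Functions in the space of \<open>Pi\<^sub>M I M\<close> are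
    \<open>undefined\<close> outside \<open>I\<close>, so \<open>restrict\<close> recovers exactly
    the function before the update.\<close>
  also have "\<dots> = distr ?Q ?Q (\<lambda>p. p)"
    using I by (intro distr_cong)
      (auto simp: space_pair_measure space_PiM PiE_iff extensional_def restrict_def fun_eq_iff)
  finally show ?thesis by simp
qed

lemma (in product_sigma_finite) AE_PiM_coordinate:
  assumes "finite I" "i \<in> I" "AE x in M i. P x"
  shows "AE f in Pi\<^sub>M I M. P (f i)"
proof -
  obtain N where N: "N \<in> null_sets (M i)" "{x \<in> space (M i). \<not> P x} \<subseteq> N"
    using assms(3) by (auto simp: eventually_ae_filter)
  let ?A = "\<lambda>j. if j = i then N else space (M j)"
  have "emeasure (Pi\<^sub>M I M) (Pi\<^sub>E I ?A) = (\<Prod>j\<in>I. emeasure (M j) (?A j))"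
    using N assms by (intro emeasure_PiM) auto
  also have "\<dots> = 0"
    using assms N by (intro prod_zero bexI[of _ i]) auto
  finally have "Pi\<^sub>E I ?A \<in> null_sets (Pi\<^sub>M I M)"
    using N assms by (intro null_setsI sets_PiM_I_finite) auto
  then show ?thesis
    by (rule AE_I') (use N assms in \<open>auto simp: space_PiM PiE_iff extensional_def\<close>)
qed

section \<open>Cramer's rule\<close>

lemma matrix_inv_mult_eq_det:
  fixes A :: "'a::field ^ 'n ^ 'n"
  assumes "invertible A"
  shows "det A * (matrix_inv A *v b) $ i =
    (\<Sum>\<pi> | \<pi> permutes UNIV.
       of_int (sign \<pi>) * (b $ \<pi> i * (\<Prod>j\<in>UNIV - {i}. A $ \<pi> j $ j)))"
proof -
  let ?B = "(\<chi> k j. if j = i then b $ k else A $ k $ j) :: 'a ^ 'n ^ 'n"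
  have "A ** matrix_inv A = mat 1"
    using someI_ex[OF assms[unfolded invertible_def]] by (simp add: matrix_inv_def)
  then have "A *v (matrix_inv A *v b) = b"
    by (simp add: matrix_vector_mul_assoc)
  then have "det A * (matrix_inv A *v b) $ i = det ?B"
    using cramer_lemma[of i A "matrix_inv A *v b"] by (simp only: mult.commute)
  \<comment> \<open>\<open>det_def\<close> lets the permutation act on the column index; transposing
    moves it to the row index, which numbers the \<open>\<phi>t\<close> in the overlap
    matrix.\<close>
  also have "\<dots> = det (transpose ?B)" by (simp add: det_transpose)
  also have "\<dots> = (\<Sum>\<pi> | \<pi> permutes UNIV.
       of_int (sign \<pi>) * (b $ \<pi> i * (\<Prod>j\<in>UNIV - {i}. A $ \<pi> j $ j)))"
    unfolding det_def
    by (intro sum.cong refl) (simp add: transpose_def prod.remove[of UNIV i])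
  finally show ?thesis .
qed

section \<open>Reduction of the integral over all particles to one variable\<close>

lemma fun_upd_prod_split:
  fixes g :: "'n::finite \<Rightarrow> 'a \<Rightarrow> 'b::comm_monoid_mult"
  shows "(\<Prod>j\<in>UNIV. g j ((\<gamma>(i := x)) j)) = g i x * (\<Prod>j\<in>UNIV - {i}. g j (\<gamma> j))"
  by (simp add: prod.remove[of UNIV i])

text \<open>\<open>h\<close> may be non-measurable, hence the completed integral in the conclusion.
  \<open>G\<close> matches the sum only almost everywhere, since the operator is computed on
  products off a null set. Integrating out all variables but one turns the products of
  \<open>\<psi>\<close> and \<open>\<phi>\<close> into overlaps, permutation by permutation.\<close>

lemma integral_alternating_sum:
  fixes M :: "'a measure" and h \<phi> \<psi> :: "'n::finite \<Rightarrow> 'a \<Rightarrow> complex"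
  defines "D \<equiv> \<lambda>\<gamma>. \<Sum>\<pi> | \<pi> permutes (UNIV :: 'n set). of_int (sign \<pi>) * (\<Prod>j\<in>UNIV. \<psi> (\<pi> j) (\<gamma> j))"
  assumes M: "sigma_finite_measure M"
    and int: "\<And>i j. integrable M (\<lambda>x. \<psi> i x * cnj (\<phi> j x))"
    and G: "integrable (Pi\<^sub>M UNIV (\<lambda>_. M)) G"
    and G_eq: "AE \<gamma> in Pi\<^sub>M UNIV (\<lambda>_. M).
      G \<gamma> = (\<Sum>i\<in>UNIV. cnj (h i (\<gamma> i)) * (\<Prod>j\<in>UNIV - {i}. cnj (\<phi> j (\<gamma> j))) * D \<gamma>)"
  shows "has_completed_integral M
     (\<lambda>x. \<Sum>i\<in>UNIV. cnj (h i x) *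
       (\<Sum>\<pi> | \<pi> permutes (UNIV :: 'n set). of_int (sign \<pi>) *
          (\<psi> (\<pi> i) x * (\<Prod>j\<in>UNIV - {i}. inner_prod M (\<psi> (\<pi> j)) (\<phi> j)))))
     (integral\<^sup>L (Pi\<^sub>M UNIV (\<lambda>_. M)) G)"
proof -
  interpret product_sigma_finite "\<lambda>_::'n. M" by unfold_locales (rule M[THEN sigma_finite_measure.sigma_finite_countable])
  let ?P = "Pi\<^sub>M UNIV (\<lambda>_::'n. M)"
  define T where "T i \<gamma> = cnj (h i (\<gamma> i)) * (\<Prod>j\<in>UNIV - {i}. cnj (\<phi> j (\<gamma> j))) * D \<gamma>" for i \<gamma>
  define F where "F i x = cnj (h i x) * (\<Sum>\<pi> | \<pi> permutes (UNIV :: 'n set). of_int (sign \<pi>) *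
          (\<psi> (\<pi> i) x * (\<Prod>j\<in>UNIV - {i}. inner_prod M (\<psi> (\<pi> j)) (\<phi> j))))" for i x
  have D_upd: "D (\<gamma>(i := x)) = (\<Sum>\<pi> | \<pi> permutes UNIV. of_int (sign \<pi>) *
      (\<psi> (\<pi> i) x * (\<Prod>j\<in>UNIV - {i}. \<psi> (\<pi> j) (\<gamma> j))))" for \<gamma> i x
    unfolding D_def by (intro sum.cong refl) (subst fun_upd_prod_split, rule refl)
  have "\<exists>I. has_completed_integral M (F i) I \<and> has_completed_integral ?P (T i) I" for i
  proof -
    let ?I = "UNIV - {i}"
    let ?Q = "Pi\<^sub>M ?I (\<lambda>_. M)"
    have insI: "insert i ?I = UNIV" by auto
    have sQ: "sigma_finite_measure ?Q" by (intro sigma_finite) simp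
    interpret QM: pair_sigma_finite ?Q M by (intro pair_sigma_finite.intro sQ M)
    \<comment> \<open>The \<open>i\<close>-th term gets finite rank: \<open>c \<pi>\<close> collects
      the sign and the factors in the other variables, while \<open>h i\<close> stays in
      \<open>f \<pi>\<close>.\<close>
    define c where "c \<pi> y = of_int (sign \<pi>) * (\<Prod>j\<in>?I. \<psi> (\<pi> j) (y j) * cnj (\<phi> j (y j)))" for \<pi> y
    define f where "f \<pi> x = cnj (h i x) * \<psi> (\<pi> i) x" for \<pi> :: "'n \<Rightarrow> 'n" and x
    let ?e = "\<lambda>(y, x). y(i := x)" and ?r = "\<lambda>\<gamma>. (restrict \<gamma> ?I, \<gamma> i)"
    have e: "?e \<in> measurable (?Q \<Otimes>\<^sub>M M) ?P"
      using measurable_add_dim[of i ?I "\<lambda>_. M"] by (simp add: insI)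
    have distr_e: "distr (?Q \<Otimes>\<^sub>M M) ?P ?e = ?P"
      using distr_insert[of ?I i] by (simp add: insI)
    have r: "?r \<in> measurable ?P (?Q \<Otimes>\<^sub>M M)"
      by (auto intro!: measurable_Pair measurable_restrict_subset)
    have distr_r: "distr ?P (?Q \<Otimes>\<^sub>M M) ?r = ?Q \<Otimes>\<^sub>M M"
      using distr_remove[of ?I i] by (simp add: insI)
    have T_upd: "T i (y(i := x)) = (\<Sum>\<pi> | \<pi> permutes UNIV. c \<pi> y * f \<pi> x)" for y x
      unfolding T_def D_upd c_def f_def
      by (simp add: sum_distrib_left prod.distrib mult_ac)
    have c_int: "integrable ?Q (c \<pi>)" for \<pi>
      unfolding c_def
      using product_integrable_prod[of ?I "\<lambda>j x. \<psi> (\<pi> j) x * cnj (\<phi> j x)"] int by simp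
    have c_eq: "integral\<^sup>L ?Q (c \<pi>) = of_int (sign \<pi>) * (\<Prod>j\<in>?I. inner_prod M (\<psi> (\<pi> j)) (\<phi> j))" for \<pi>
      unfolding c_def inner_prod_def
      using product_integral_prod[of ?I "\<lambda>j x. \<psi> (\<pi> j) x * cnj (\<phi> j x)"] int by simp
    \<comment> \<open>For \<open>k \<noteq> i\<close> the value \<open>h k (y k)\<close> is constant
      in \<open>x\<close>, which enters only through the integrable products
      \<open>\<psi> (\<pi> i) x * cnj (\<phi> i x)\<close>.\<close>
    have other: "integrable M (\<lambda>x. T k (y(i := x)))" if "k \<noteq> i" for k y
    proof -
      have "(\<Prod>j\<in>UNIV - {k}. cnj (\<phi> j ((y(i := x)) j))) =
          cnj (\<phi> i x) * (\<Prod>j\<in>UNIV - {k} - {i}. cnj (\<phi> j (y j)))" for x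
        using that by (subst prod.remove[of _ i]) (auto intro!: prod.cong)
      then have "T k (y(i := x)) = (\<Sum>\<pi> | \<pi> permutes UNIV.
          (cnj (h k (y k)) * (\<Prod>j\<in>UNIV - {k} - {i}. cnj (\<phi> j (y j))) * of_int (sign \<pi>) *
           (\<Prod>j\<in>?I. \<psi> (\<pi> j) (y j))) * (\<psi> (\<pi> i) x * cnj (\<phi> i x)))" for x
        using that unfolding T_def D_upd by (simp add: sum_distrib_left mult_ac)
      then show ?thesis using int by simp
    qed
    have "integrable (?Q \<Otimes>\<^sub>M M) (\<lambda>p. G (?e p))"
      by (rule integrable_distr[OF e]) (simp only: distr_e G)
    then have "AE y in ?Q. integrable M (\<lambda>x. G (?e (y, x)))"
      by (rule QM.AE_integrable_fst')
    moreover have "AE y in ?Q. AE x in M. G (?e (y, x)) = (\<Sum>k\<in>UNIV. T k (?e (y, x)))"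
      by (rule QM.AE_pair, rule AE_distrD[OF e]) (use G_eq in \<open>simp only: distr_e T_def\<close>)
    ultimately have "AE y in ?Q. \<exists>I. has_completed_integral M (\<lambda>x. \<Sum>\<pi> | \<pi> permutes UNIV. c \<pi> y * f \<pi> x) I"
    proof eventually_elim
      case (elim y)
      \<comment> \<open>Subtracting the other terms from the total isolates the \<open>i\<close>-th
        one up to a null set.\<close>
      let ?u = "\<lambda>x. G (y(i := x)) - (\<Sum>k\<in>UNIV - {i}. T k (y(i := x)))"
      have u: "integrable M ?u"
        using elim(1) other by (intro Bochner_Integration.integrable_diff Bochner_Integration.integrable_sum) auto
      have "AE x in M. ?u x = (\<Sum>\<pi> | \<pi> permutes UNIV. c \<pi> y * f \<pi> x)"
        using elim(2) by eventually_elim (simp add: sum.remove[of UNIV i] T_upd)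
      from has_completed_integral_cong_AE[OF has_completed_integral_integrable[OF u] this]
      show ?case ..
    qed
    from has_completed_integral_sum_tensor[OF sQ M _ c_int this] obtain I where
      I1: "has_completed_integral M (\<lambda>x. \<Sum>\<pi> | \<pi> permutes UNIV. integral\<^sup>L ?Q (c \<pi>) * f \<pi> x) I" and
      I2: "has_completed_integral (?Q \<Otimes>\<^sub>M M) (\<lambda>p. \<Sum>\<pi> | \<pi> permutes UNIV. c \<pi> (fst p) * f \<pi> (snd p)) I"
      by (auto simp: finite_permutations)
    have "(\<lambda>x. \<Sum>\<pi> | \<pi> permutes UNIV. integral\<^sup>L ?Q (c \<pi>) * f \<pi> x) = F i"
      by (simp add: c_eq f_def F_def fun_eq_iff sum_distrib_left mult_ac)
    moreover have "(\<Sum>\<pi> | \<pi> permutes UNIV. c \<pi> (restrict \<gamma> ?I) * f \<pi> (\<gamma> i)) = T i \<gamma>" for \<gamma>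
    proof -
      have "(restrict \<gamma> ?I)(i := \<gamma> i) = \<gamma>" by auto
      then show ?thesis using T_upd[of "restrict \<gamma> ?I" "\<gamma> i"] by simp
    qed
    ultimately show ?thesis
      using I1 has_completed_integral_distr[OF I2 r distr_r] by (simp only: fst_conv snd_conv) blast
  qed
  then obtain I where "\<And>i. has_completed_integral M (F i) (I i)"
    and T: "\<And>i. has_completed_integral ?P (T i) (I i)"
    by metis
  then have F: "has_completed_integral M (\<lambda>x. \<Sum>i\<in>UNIV. F i x) (\<Sum>i\<in>UNIV. I i)"
    by (intro has_completed_integral_sum)
  have "has_completed_integral ?P G (\<Sum>i\<in>UNIV. I i)"
    by (rule has_completed_integral_cong_AE[OF has_completed_integral_sum[OF T]])
       (use G_eq in \<open>auto simp: T_def elim!: eventually_mono\<close>)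
  from has_completed_integral_integral_eq[OF this G] F show ?thesis
    unfolding F_def by simp
qed

section \<open>The one-particle operators on products\<close>

lemma twice_differentiable_along_cmult:
  assumes "twice_differentiable_along f x e"
  shows "twice_differentiable_along (\<lambda>y. c * f y) x e"
    and "second_derivative_along (\<lambda>y. c * f y) x e = c * second_derivative_along f x e"
proof -
  let ?g = "\<lambda>s. f (x + s *\<^sub>R e)"
  have ev: "\<forall>\<^sub>F t in nhds 0. ?g differentiable (at t)"
    and d2: "(\<lambda>t. vector_derivative ?g (at t)) differentiable (at 0)"
    using assms unfolding twice_differentiable_along_def by auto
  have vd: "vector_derivative (\<lambda>s. c * g s) (at t) = c * vector_derivative g (at t)"
    "(\<lambda>s. c * g s) differentiable (at t)" if "g differentiable (at t)" for t and g :: "real \<Rightarrow> complex"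
    using that has_vector_derivative_mult_right[of g _ "at t" c]
    by (auto simp: vector_derivative_works intro!: vector_derivative_at differentiableI_vector)
  \<comment> \<open>The first derivatives are compared only for \<open>t\<close> near 0, which is
    all that the derivative at 0 sees.\<close>
  have eq: "\<forall>\<^sub>F t in nhds 0. c * vector_derivative ?g (at t) = vector_derivative (\<lambda>s. c * ?g s) (at t)"
    using ev by eventually_elim (simp add: vd)
  have "((\<lambda>t. vector_derivative (\<lambda>s. c * ?g s) (at t)) has_vector_derivative
      c * vector_derivative (\<lambda>t. vector_derivative ?g (at t)) (at 0)) (at 0)"
    using has_vector_derivative_mult_right[OF d2[unfolded vector_derivative_works], of c]
      eventually_mono[OF eq] eventually_nhds_x_imp_x[OF eq]
    by (subst has_vector_derivative_cong_ev[symmetric]) auto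
  then show "second_derivative_along (\<lambda>y. c * f y) x e = c * second_derivative_along f x e"
    and "twice_differentiable_along (\<lambda>y. c * f y) x e"
    unfolding second_derivative_along_def twice_differentiable_along_def
    using ev by (auto intro: vector_derivative_at differentiableI_vector vd elim!: eventually_mono)
qed

lemma laplacian_cmult:
  assumes "laplacian_exists f x"
  shows "laplacian (\<lambda>y. c * f y) x = c * laplacian f x"
  using assms twice_differentiable_along_cmult[of f x _ c]
  by (simp add: laplacian_def laplacian_exists_def sum_distrib_left)

text \<open>As a function of one particle alone, a product is one orbital times a constant, and the
  constant passes through the Laplacian.\<close>

lemma sum_one_particle_op_product_fun:
  assumes "\<And>i. laplacian_exists (\<lambda>r. \<phi> i (r, snd (\<gamma> i))) (fst (\<gamma> i))"
  shows "sum_one_particle_op v (product_fun \<phi>) \<gamma> =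
    (\<Sum>i\<in>UNIV. one_particle_op v (\<phi> i) (\<gamma> i) * (\<Prod>j\<in>UNIV - {i}. \<phi> j (\<gamma> j)))"
  unfolding sum_one_particle_op_def
proof (intro sum.cong refl)
  fix i
  let ?c = "\<Prod>j\<in>UNIV - {i}. \<phi> j (\<gamma> j)"
  have upd: "product_fun \<phi> (\<gamma>(i := p)) = ?c * \<phi> i p" for p
    unfolding product_fun_def by (subst fun_upd_prod_split) (rule mult.commute)
  have "laplacian_at i (product_fun \<phi>) \<gamma> = ?c * laplacian (\<lambda>r. \<phi> i (r, snd (\<gamma> i))) (fst (\<gamma> i))"
    unfolding laplacian_at_def upd by (rule laplacian_cmult) (rule assms)
  then show "- (1 / 2) * laplacian_at i (product_fun \<phi>) \<gamma> + of_real (v (fst (\<gamma> i))) * product_fun \<phi> \<gamma> =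
      one_particle_op v (\<phi> i) (\<gamma> i) * ?c"
    using upd[of "\<gamma> i"] by (simp add: one_particle_op_def algebra_simps)
qed

section \<open>Antisymmetrized products and overlaps\<close>

text \<open>The antisymmetrizer permutes the variables, whereas the Cramer expansion permutes the
  orbitals. Passing to the inverse permutation, which has the same sign, converts one into the
  other.\<close>

lemma antisymmetrizer_product_fun:
  fixes \<phi> :: "'n::finite \<Rightarrow> particle \<Rightarrow> complex"
  shows "fact CARD('n) * antisymmetrizer (product_fun \<phi>) \<gamma> =
    (\<Sum>\<pi> | \<pi> permutes (UNIV :: 'n set). of_int (sign \<pi>) * (\<Prod>j\<in>UNIV. \<phi> (\<pi> j) (\<gamma> j)))"
proof -
  have "fact CARD('n) * antisymmetrizer (product_fun \<phi>) \<gamma> =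
    (\<Sum>\<pi> | \<pi> permutes (UNIV :: 'n set). of_int (sign \<pi>) * (\<Prod>j\<in>UNIV. \<phi> j (\<gamma> (\<pi> j))))"
    by (simp add: antisymmetrizer_def product_fun_def)
  also have "\<dots> = (\<Sum>\<pi> | \<pi> permutes (UNIV :: 'n set).
      of_int (sign (inv \<pi>)) * (\<Prod>j\<in>UNIV. \<phi> j (\<gamma> (inv \<pi> j))))"
    by (rule sum_permutations_inverse)
  also have "\<dots> = (\<Sum>\<pi> | \<pi> permutes (UNIV :: 'n set).
      of_int (sign \<pi>) * (\<Prod>j\<in>UNIV. \<phi> (\<pi> j) (\<gamma> j)))"
  proof (intro sum.cong refl)
    fix \<pi> :: "'n \<Rightarrow> 'n" assume "\<pi> \<in> {\<pi>. \<pi> permutes UNIV}"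
    then have p: "\<pi> permutes UNIV" by simp
    have "(\<Prod>j\<in>UNIV. \<phi> j (\<gamma> (inv \<pi> j))) = (\<Prod>j\<in>UNIV. \<phi> (\<pi> j) (\<gamma> (inv \<pi> (\<pi> j))))"
      using prod.permute[OF p, of "\<lambda>j. \<phi> j (\<gamma> (inv \<pi> j))"] by (simp add: o_def)
    then show "of_int (sign (inv \<pi>)) * (\<Prod>j\<in>UNIV. \<phi> j (\<gamma> (inv \<pi> j))) =
        of_int (sign \<pi>) * (\<Prod>j\<in>UNIV. \<phi> (\<pi> j) (\<gamma> j))"
      using p by (simp add: sign_inverse permutes_inverses permutation_permutes[THEN iffD2]
          exI[of _ UNIV])
  qed
  finally show ?thesis .
qed

lemma square_integrable_mult_cnj:
  assumes "square_integrable M f" "square_integrable M g"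
  shows "integrable M (\<lambda>x. f x * cnj (g x))"
proof (rule Bochner_Integration.integrable_bound)
  show "integrable M (\<lambda>x. (cmod (f x))\<^sup>2 + (cmod (g x))\<^sup>2)"
    using assms by (auto simp: square_integrable_def)
  have "cmod (f x * cnj (g x)) \<le> (cmod (f x))\<^sup>2 + (cmod (g x))\<^sup>2" for x
  proof -
    have "0 \<le> cmod (f x) * cmod (g x)" by simp
    then show ?thesis
      using sum_squares_bound[of "cmod (f x)" "cmod (g x)"]
      unfolding norm_mult complex_mod_cnj by linarith
  qed
  then show "AE x in M. cmod (f x * cnj (g x)) \<le> norm ((cmod (f x))\<^sup>2 + (cmod (g x))\<^sup>2)"
    by (auto intro: order_trans)
  have "(\<lambda>x. cnj (g x)) \<in> borel_measurable M"
    using assms by (intro measurable_compose[OF _ borel_measurable_continuous_onI[of cnj]])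
      (auto simp: square_integrable_def intro: continuous_intros)
  then show "(\<lambda>x. f x * cnj (g x)) \<in> borel_measurable M"
    using assms by (auto simp: square_integrable_def)
qed

lemma sigma_finite_particle_measure: "sigma_finite_measure particle_measure"
proof -
  interpret pair_sigma_finite "lebesgue :: (real ^ 3) measure" "count_space spins"
    by (intro pair_sigma_finite.intro sigma_finite_lebesgue sigma_finite_measure_count_space_finite) simp
  show ?thesis unfolding particle_measure_def by (rule P.sigma_finite_measure_axioms)
qed

theorem proposition11:
  fixes \<phi> \<phi>t :: "'n::finite \<Rightarrow> particle \<Rightarrow> complex"
    and A :: "'a set" and Z :: "'a \<Rightarrow> real" and R :: "'a \<Rightarrow> real ^ 3"
    and v :: "real ^ 3 \<Rightarrow> real"
    and L :: "complex ^ 'n ^ 'n" and \<Theta> :: "particle \<Rightarrow> complex ^ 'n"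
  assumes "finite A" and "\<And>a. a \<in> A \<Longrightarrow> Z a > 0"
    and v_def: "v = nuclear_potential A Z R"
    and "\<And>i. square_integrable particle_measure (\<phi> i)"
    and "\<And>i. square_integrable particle_measure (\<phi>t i)"
    and "\<And>i. AE \<gamma> in particle_measure. laplacian_exists (\<lambda>r. \<phi> i (r, snd \<gamma>)) (fst \<gamma>)"
    and L_def: "L = overlap_matrix \<phi>t \<phi>"
    and "invertible L"
    and Theta_def: "\<Theta> = (\<lambda>\<gamma>. matrix_inv L *v column_fun \<phi>t \<gamma>)"
    and "integrable particles_measure
           (\<lambda>\<gamma>. antisymmetrizer (product_fun \<phi>t) \<gamma> *
                 cnj (sum_one_particle_op v (product_fun \<phi>) \<gamma>))"
    and "integrable particle_measure
           (\<lambda>\<gamma>. adjoint_mult (one_particle_op_vec v (column_fun \<phi>) \<gamma>) (\<Theta> \<gamma>))"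
  shows "inner_prod particles_measure
           (antisymmetrizer (product_fun \<phi>t)) (sum_one_particle_op v (product_fun \<phi>)) =
         det L / fact CARD('n) *
           (\<integral>\<gamma>. adjoint_mult (one_particle_op_vec v (column_fun \<phi>) \<gamma>) (\<Theta> \<gamma>) \<partial>particle_measure)"
proof -
  let ?n = "fact CARD('n) :: complex"
  let ?G = "\<lambda>\<gamma>. antisymmetrizer (product_fun \<phi>t) \<gamma> *
                 cnj (sum_one_particle_op v (product_fun \<phi>) \<gamma>)"
  let ?g = "\<lambda>\<gamma>. adjoint_mult (one_particle_op_vec v (column_fun \<phi>) \<gamma>) (\<Theta> \<gamma>)"
  let ?h = "\<lambda>i. one_particle_op v (\<phi> i)"
  interpret product_sigma_finite "\<lambda>_::'n. particle_measure"
    by unfold_locales (rule sigma_finite_particle_measure[THEN sigma_finite_measure.sigma_finite_countable])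
  have G: "integrable (Pi\<^sub>M UNIV (\<lambda>_. particle_measure)) (\<lambda>\<gamma>. ?n * ?G \<gamma>)"
    using assms(10) by (simp add: particles_measure_def)
  have "AE \<gamma> in Pi\<^sub>M UNIV (\<lambda>_. particle_measure).
      \<forall>i. laplacian_exists (\<lambda>r. \<phi> i (r, snd (\<gamma> i))) (fst (\<gamma> i))"
    using assms(6) by (subst AE_all_countable) (auto intro: AE_PiM_coordinate)
  then have "AE \<gamma> in Pi\<^sub>M UNIV (\<lambda>_. particle_measure). ?n * ?G \<gamma> =
      (\<Sum>i\<in>UNIV. cnj (?h i (\<gamma> i)) * (\<Prod>j\<in>UNIV - {i}. cnj (\<phi> j (\<gamma> j))) *
        (\<Sum>\<pi> | \<pi> permutes (UNIV :: 'n set). of_int (sign \<pi>) * (\<Prod>j\<in>UNIV. \<phi>t (\<pi> j) (\<gamma> j))))"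
  proof eventually_elim
    case (elim \<gamma>)
    have "?n * ?G \<gamma> = cnj (sum_one_particle_op v (product_fun \<phi>) \<gamma>) *
        (?n * antisymmetrizer (product_fun \<phi>t) \<gamma>)"
      by (simp only: mult_ac)
    then show ?case
      using elim
      by (simp only: antisymmetrizer_product_fun sum_one_particle_op_product_fun
          cnj_sum cnj_prod complex_cnj_mult sum_distrib_right)
  qed
  note integral_alternating_sum[OF sigma_finite_particle_measure
      square_integrable_mult_cnj[OF assms(5) assms(4)] G this]
  \<comment> \<open>The inner sum is the Cramer expansion for \<open>L\<close> with column
    \<open>i\<close> replaced by the values \<open>\<phi>t k x\<close>, hence \<open>det L\<close>
    times the \<open>i\<close>-th entry of \<open>\<Theta> x\<close>.\<close>
  moreover have "(\<Sum>i\<in>UNIV. cnj (?h i x) * (\<Sum>\<pi> | \<pi> permutes (UNIV :: 'n set). of_int (sign \<pi>) *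
        (\<phi>t (\<pi> i) x * (\<Prod>j\<in>UNIV - {i}. inner_prod particle_measure (\<phi>t (\<pi> j)) (\<phi> j))))) =
      det L * ?g x" for x
    using matrix_inv_mult_eq_det[OF assms(8), of "column_fun \<phi>t x"]
    by (simp add: adjoint_mult_def one_particle_op_vec_def column_fun_def Theta_def L_def
        overlap_matrix_def sum_distrib_left mult.left_commute[of "det _"])
  ultimately have "has_completed_integral particle_measure (\<lambda>x. det L * ?g x)
      (\<integral>\<gamma>. ?n * ?G \<gamma> \<partial>Pi\<^sub>M UNIV (\<lambda>_. particle_measure))"
    by simp
  \<comment> \<open>Integrability of the one-particle integrand turns its completed integral into
    the Bochner integral of the claim.\<close>
  from has_completed_integral_integral_eq[OF this] assms(11)
  have "det L * (\<integral>x. ?g x \<partial>particle_measure) = ?n * (\<integral>\<gamma>. ?G \<gamma> \<partial>particles_measure)"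
    by (simp add: particles_measure_def)
  then show ?thesis
    by (simp add: inner_prod_def field_simps)
qed

end
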